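(* The number of permutations of cycle type $\alpha=(1^{m_1}2^{m_2}\ldots)$ is in $\#\mathsf{L}$, as the function $$(1^{m_1}\,0\,1^{m_2}\,0\,\dots)\ \mapsto\ \frac{n!}{z_\alpha}.$$
   Context: For $\alpha=(1^{m_1}2^{m_2}\dots)$, the partition with $m_i\ge 0$ parts equal to $i$, put $n=\sum_i i\,m_i$ and $z_\alpha=\prod_i i^{m_i}m_i!$; then $n!/z_\alpha$ is the number of permutations in $S_n$ having exactly $m_i$ cycles of length $i$ for every $i$. The alphabet is $\Sigma=\{0,1\}$; in the input string $1^{m_i}$ denotes a string of $m_i$ ones, and juxtaposition is concatenation. A function given only on strings of a specified form is extended by $0$ to all other strings. $\#\mathsf{L}$ is the class of functions $f:\Sigma^*\to\mathbb{N}_0$ such that $f(x)$ is the number of accepting computation paths on input $x$ of a fixed nondeterministic Turing machine with read-only input tape that uses $O(\log|x|)$ work space and halts on every computation path. Equivalently: there are a polynomial $q$ and a deterministic $O(\log|x|)$-space Turing machine $M$ with an additional read-once, left-to-right witness tape such that $f(x)=\#\{w\in\Sigma^{q(|x|)}\mid M(x,w)=\mathsf{yes}\}$. *)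

theory Defs
  imports Complex_Main "HOL-Library.Landau_Symbols"
begin

section \<open>Nondeterministic Turing machines with a read-only input tape\<close>

datatype dir = Lft | Stay | Rgt

datatype isym = LeftEnd | Bit bool | RightEnd

text \<open>
  States and work symbols are natural numbers, and 0 is the blank symbol. Since the transition
  table of a machine is required to be finite, only finitely many states and symbols matter.
  The list entries belong to the work tapes, in order.
\<close>

record transition =
  src :: nat
  iread :: isym
  wread :: "nat list"
  dst :: nat
  imove :: dir
  wacts :: "(nat \<times> dir) list"

record ntm =
  ntapes :: nat
  delta :: "transition set"
  start :: nat
  accepting :: "nat set"

definition wf_ntm :: "ntm \<Rightarrow> bool" where
  "wf_ntm M \<longleftrightarrow> finite (delta M) \<and>
     (\<forall>t\<in>delta M. length (wread t) = ntapes M \<and> length (wacts t) = ntapes M)"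

text \<open>
  Work tapes are infinite to the right only; each is a pair of contents and head position.
\<close>

record config =
  state :: nat
  ipos :: nat
  wtapes :: "((nat \<Rightarrow> nat) \<times> nat) list"

definition init_config :: "ntm \<Rightarrow> config" where
  "init_config M = \<lparr>state = start M, ipos = 0, wtapes = replicate (ntapes M) (\<lambda>_. 0, 0)\<rparr>"

definition input_symbol :: "bool list \<Rightarrow> nat \<Rightarrow> isym" where
  "input_symbol x p =
     (if p = 0 then LeftEnd else if p \<le> length x then Bit (x ! (p - 1)) else RightEnd)"

text \<open>A head at the left end of its tape stays there when told to move left.\<close>

fun move :: "dir \<Rightarrow> nat \<Rightarrow> nat" where
  "move Lft h = h - 1"
| "move Stay h = h"
| "move Rgt h = h + 1"

definition enabled :: "ntm \<Rightarrow> bool list \<Rightarrow> config \<Rightarrow> transition \<Rightarrow> bool" where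
  "enabled M x c t \<longleftrightarrow> t \<in> delta M \<and> src t = state c \<and> iread t = input_symbol x (ipos c) \<and>
     wread t = map (\<lambda>(tp, h). tp h) (wtapes c)"

text \<open>The input head cannot leave the input and its two end markers.\<close>

definition apply_transition :: "bool list \<Rightarrow> transition \<Rightarrow> config \<Rightarrow> config" where
  "apply_transition x t c =
     \<lparr>state = dst t,
      ipos = min (length x + 1) (move (imove t) (ipos c)),
      wtapes = map2 (\<lambda>(a, d) (tp, h). (tp(h := a), move d h)) (wacts t) (wtapes c)\<rparr>"

text \<open>
  A computation is recorded by the sequence of transitions taken, so that two different
  nondeterministic choices count as different even if they lead to the same configuration.
\<close>

inductive run :: "ntm \<Rightarrow> bool list \<Rightarrow> config \<Rightarrow> transition list \<Rightarrow> config \<Rightarrow> bool"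
  for M x where
  run_Nil: "run M x c [] c"
| run_Cons: "enabled M x c t \<Longrightarrow> run M x (apply_transition x t c) ts c' \<Longrightarrow> run M x c (t # ts) c'"

definition halted :: "ntm \<Rightarrow> bool list \<Rightarrow> config \<Rightarrow> bool" where
  "halted M x c \<longleftrightarrow> (\<nexists>t. enabled M x c t)"

definition halts_on_all_paths :: "ntm \<Rightarrow> bool list \<Rightarrow> bool" where
  "halts_on_all_paths M x \<longleftrightarrow>
     \<not> (\<exists>cs. cs 0 = init_config M \<and>
          (\<forall>i::nat. \<exists>t. enabled M x (cs i) t \<and> cs (Suc i) = apply_transition x t (cs i)))"

definition accepting_paths :: "ntm \<Rightarrow> bool list \<Rightarrow> transition list set" where
  "accepting_paths M x =
     {ts. \<exists>c. run M x (init_config M) ts c \<and> halted M x c \<and> state c \<in> accepting M}"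

text \<open>
  At most \<open>b\<close> cells are visited on each work tape, on every computation path. The number of
  tapes is a constant of the machine, so bounding the tapes one by one or in total is the same
  up to a constant factor.
\<close>

definition work_space_le :: "ntm \<Rightarrow> bool list \<Rightarrow> nat \<Rightarrow> bool" where
  "work_space_le M x b \<longleftrightarrow>
     (\<forall>ts c. run M x (init_config M) ts c \<longrightarrow> (\<forall>(tp, h)\<in>set (wtapes c). h < b))"

text \<open>The use of \<open>card\<close> is harmless: see lemma \<open>finite_accepting_paths\<close> below.\<close>

definition SharpL :: "(bool list \<Rightarrow> nat) set" where
  "SharpL = {f. \<exists>M s. wf_ntm M \<and> (\<lambda>n. real (s n)) \<in> O(\<lambda>n. ln (real n)) \<and>
     (\<forall>x. halts_on_all_paths M x \<and> work_space_le M x (s (length x)) \<and>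
          f x = card (accepting_paths M x))}"

lemma finite_runs:
  assumes fin: "finite (delta M)"
    and noinf: "\<not> (\<exists>cs. cs 0 = c \<and>
          (\<forall>i::nat. \<exists>t. enabled M x (cs i) t \<and> cs (Suc i) = apply_transition x t (cs i)))"
  shows "finite {ts. \<exists>c'. run M x c ts c'}"
proof (rule ccontr)
  define Inf where "Inf d \<longleftrightarrow> infinite {ts. \<exists>c'. run M x d ts c'}" for d
  have step: "\<exists>d'. Inf d' \<and> (\<exists>t. enabled M x d t \<and> d' = apply_transition x t d)" if "Inf d" for d
  proof (rule ccontr)
    assume "\<not> ?thesis"
    then have *: "finite {ts. \<exists>c'. run M x (apply_transition x t d) ts c'}" if "enabled M x d t" for t
      using that unfolding Inf_def by blast
    have "{ts. \<exists>c'. run M x d ts c'} \<subseteq> {[]} \<union>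
       (\<Union>t\<in>{t\<in>delta M. enabled M x d t}. (#) t ` {ts. \<exists>c'. run M x (apply_transition x t d) ts c'})"
    proof
      fix ts assume "ts \<in> {ts. \<exists>c'. run M x d ts c'}"
      then obtain c' where "run M x d ts c'" by blast
      then show "ts \<in> {[]} \<union> (\<Union>t\<in>{t\<in>delta M. enabled M x d t}.
          (#) t ` {ts. \<exists>c'. run M x (apply_transition x t d) ts c'})"
        by cases (auto simp: enabled_def)
    qed
    moreover have "finite \<dots>" using fin * by auto
    ultimately show False using that finite_subset unfolding Inf_def by blast
  qed
  assume "infinite {ts. \<exists>c'. run M x c ts c'}"
  then have "Inf c" unfolding Inf_def .
  have "\<exists>cs. \<forall>i. (Inf (cs i) \<and> (i = 0 \<longrightarrow> cs i = c)) \<and>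
     (\<exists>t. enabled M x (cs i) t \<and> cs (Suc i) = apply_transition x t (cs i))"
  proof (rule dependent_nat_choice)
    show "\<exists>d. Inf d \<and> (0 = (0::nat) \<longrightarrow> d = c)" using \<open>Inf c\<close> by blast
  next
    fix d and i :: nat
    assume "Inf d \<and> (i = 0 \<longrightarrow> d = c)"
    then show "\<exists>d'. (Inf d' \<and> (Suc i = 0 \<longrightarrow> d' = c)) \<and>
        (\<exists>t. enabled M x d t \<and> d' = apply_transition x t d)"
      using step[of d] by auto
  qed
  then show False using noinf by blast
qed

lemma finite_accepting_paths:
  assumes "wf_ntm M" "halts_on_all_paths M x"
  shows "finite (accepting_paths M x)"
proof -
  have "finite {ts. \<exists>c'. run M x (init_config M) ts c'}"
    using finite_runs assms unfolding wf_ntm_def halts_on_all_paths_def by blast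
  then show ?thesis
    by (rule rev_finite_subset) (auto simp: accepting_paths_def)
qed

section \<open>Cycle types\<close>

text \<open>
  A partition is given by the list of the multiplicities of its parts; as lists are indexed
  from 0, the entry \<open>ms ! i\<close> is the number of parts equal to \<open>i + 1\<close>. Trailing zeros do not
  change the partition.
\<close>

definition part_size :: "nat list \<Rightarrow> nat" where
  "part_size ms = (\<Sum>i<length ms. (i + 1) * ms ! i)"

definition zee :: "nat list \<Rightarrow> nat" where
  "zee ms = (\<Prod>i<length ms. (i + 1) ^ (ms ! i) * fact (ms ! i))"

text \<open>The letter 1 is \<^const>\<open>True\<close> and the letter 0 is \<^const>\<open>False\<close>.\<close>

fun encode :: "nat list \<Rightarrow> bool list" where
  "encode [] = []"
| "encode [m] = replicate m True"
| "encode (m # m' # ms) = replicate m True @ False # encode (m' # ms)"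

text \<open>
  The quotient is exact (\<open>zee_dvd_fact\<close>), and the value does not depend on the choice of
  \<open>ms\<close> (\<open>cycle_type_count_encode\<close>).
\<close>

definition cycle_type_count :: "bool list \<Rightarrow> nat" where
  "cycle_type_count x =
     (if \<exists>ms. x = encode ms
      then let ms = (SOME ms. x = encode ms) in fact (part_size ms) div zee ms
      else 0)"

lemma power_mult_fact_dvd_fact: "k ^ m * fact m dvd (fact (k * m) :: nat)" if "k > 0"
proof (induction m)
  case (Suc m)
  have "fact (k * Suc m) = k * Suc m * (fact (k * m + (k - 1)) :: nat)"
    using that fact_reduce[of "k * Suc m", where ?'a = nat] by (simp add: algebra_simps)
  moreover have "fact (k * m) dvd (fact (k * m + (k - 1)) :: nat)"
    by (rule fact_dvd) simp
  then have "k ^ m * fact m dvd (fact (k * m + (k - 1)) :: nat)"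
    using Suc dvd_trans by blast
  then have "k * Suc m * (k ^ m * fact m) dvd k * Suc m * (fact (k * m + (k - 1)) :: nat)"
    by (rule mult_dvd_mono[OF dvd_refl])
  moreover have "k ^ Suc m * fact (Suc m) = k * Suc m * (k ^ m * fact m)"
    by (simp add: algebra_simps)
  ultimately show ?case by (simp only:)
qed simp

lemma zee_dvd_fact: "zee ms dvd fact (part_size ms)"
proof (induction ms rule: rev_induct)
  case (snoc m ms)
  let ?k = "length ms + 1"
  have "zee (ms @ [m]) = zee ms * (?k ^ m * fact m)"
    by (simp add: zee_def nth_append)
  moreover have "part_size (ms @ [m]) = part_size ms + ?k * m"
    by (simp add: part_size_def nth_append)
  moreover have "zee ms * (?k ^ m * fact m) dvd fact (part_size ms) * fact (?k * m)"
    by (intro mult_dvd_mono snoc power_mult_fact_dvd_fact) simp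
  moreover have "fact (part_size ms) * fact (?k * m) dvd (fact (part_size ms + ?k * m) :: nat)"
    by (rule fact_fact_dvd_fact)
  ultimately show ?case by (metis dvd_trans)
qed (simp add: zee_def)

fun runs :: "bool list \<Rightarrow> nat list" where
  "runs [] = [0]"
| "runs (False # xs) = 0 # runs xs"
| "runs (True # xs) = (case runs xs of [] \<Rightarrow> [] | m # ms \<Rightarrow> Suc m # ms)"

lemma runs_encode: "ms \<noteq> [] \<Longrightarrow> runs (encode ms) = ms"
proof (induction ms rule: encode.induct)
  case (2 m)
  show ?case by (induction m) auto
next
  case (3 m m' ms)
  have "runs (replicate k True @ False # encode (m' # ms)) = k # m' # ms" for k
    using 3 by (induction k) auto
  then show ?case by simp
qed simp

lemma encode_surj: "\<exists>ms. x = encode ms"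
proof -
  have "runs x \<noteq> [] \<and> encode (runs x) = x"
  proof (induction x rule: runs.induct)
    case (3 xs)
    then obtain m ms where "runs xs = m # ms" by (cases "runs xs") auto
    with 3 show ?case by (cases ms) auto
  next
    case (2 xs)
    then show ?case by (cases "runs xs") auto
  qed simp
  then show ?thesis by metis
qed

lemma cycle_type_count_encode:
  "cycle_type_count (encode ms) = fact (part_size ms) div zee ms"
proof -
  define ns where "ns = (SOME ns. encode ms = encode ns)"
  have e: "encode ms = encode ns"
    unfolding ns_def by (rule someI[of _ ms]) simp
  have runs': "runs (encode l) = (if l = [] then [0] else l)" for l
    by (simp add: runs_encode)
  have zero: "part_size [0] = part_size []" "zee [0] = zee []"
    by (simp_all add: part_size_def zee_def)
  have "(if ms = [] then [0] else ms) = (if ns = [] then [0] else ns)"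
    using e runs' by metis
  then have "part_size ms = part_size ns \<and> zee ms = zee ns"
    using zero by (auto split: if_splits)
  then show ?thesis
    unfolding cycle_type_count_def Let_def ns_def by auto
qed

lemma real_cycle_type_count_encode:
  "real (cycle_type_count (encode ms)) = fact (part_size ms) / real (zee ms)"
  using zee_dvd_fact[of ms] by (simp add: cycle_type_count_encode real_of_nat_div)

end

theory Submission
  imports Defs "HOL-Real_Asymp.Real_Asymp"
begin

text \<open>
  The quotient $n!/z_\alpha$ has to be written as a product of numbers, each of which is the
  number of outcomes of a logarithmic-space nondeterministic search; doing the searches one after
  another multiplies their numbers of accepting paths. Put $S_i = \sum_{j \le i} j m_j$. Then
  \[ \frac{n!}{z_\alpha} = \prod_i \binom{S_i}{i m_i} \prod_{t \le i m_i,\ i \nmid t} t, \]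
  because $(i m_i)!$ is $i^{m_i} m_i!$ times the product of the $t \le i m_i$ that are not
  multiples of $i$, and the binomial coefficients telescope. A factor $t$ is realised by choosing
  one of $t$ units of a counter. The binomial coefficient counts the weakly decreasing sequences
  $S_{i-1} \ge z_1 \ge \dots \ge z_{i m_i} \ge 0$, which are guessed by lowering a counter
  nondeterministically, $i$ times for each letter 1 of the block of $i$. Both are interleaved in a
  single left-to-right pass over the input (\<open>cycle_part\<close>, \<open>cycle_block\<close>,
  \<open>cycle_blocks\<close>) which needs six counters, all of them at most
  $(|x| + 1)^2$ and hence of logarithmic length in binary.

  Computation paths are counted with the inductive predicate \<open>counts\<close>. A single derivation
  of it shows termination, the space bound and the number of accepting paths, so that all three
  are established together. Counter programs are translated into Turing machines that keep each
  counter in binary on a tape of its own; the rules \<open>from_counts_Inc\<close>,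
  \<open>from_counts_Dec\<close>, \<open>from_counts_Choose\<close> and so on lift \<open>counts\<close>
  to the level of counter programs, where it is computed backwards from the accepting
  instruction.
\<close>

section \<open>Counting computation paths\<close>

text \<open>
  \<open>counts M x b c k\<close>: all computation paths from the configuration \<open>c\<close> end, all
  work heads stay below \<open>b\<close> on them, and exactly \<open>k\<close> of the maximal ones are accepting.
\<close>

inductive counts :: "ntm \<Rightarrow> bool list \<Rightarrow> nat \<Rightarrow> config \<Rightarrow> nat \<Rightarrow> bool"
  for M x b where
  counts_halted: "\<forall>(f, h) \<in> set (wtapes c). h < b \<Longrightarrow> halted M x c \<Longrightarrow>
     counts M x b c (if state c \<in> accepting M then 1 else 0)"
| counts_step: "\<forall>(f, h) \<in> set (wtapes c). h < b \<Longrightarrow> \<not> halted M x c \<Longrightarrow>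
     (\<And>t. enabled M x c t \<Longrightarrow> counts M x b (apply_transition x t c) (k t)) \<Longrightarrow>
     counts M x b c (\<Sum>t | enabled M x c t. k t)"

lemma run_Nil_iff: "run M x c [] c' \<longleftrightarrow> c' = c"
  by (auto elim: run.cases intro: run.intros)

lemma run_Cons_iff:
  "run M x c (t # ts) c' \<longleftrightarrow> enabled M x c t \<and> run M x (apply_transition x t c) ts c'"
  by (auto elim: run.cases intro: run.intros)

lemma counts_space:
  assumes "counts M x b c k" "run M x c ts c'"
  shows "\<forall>(f, h) \<in> set (wtapes c'). h < b"
  using assms
proof (induction arbitrary: ts rule: counts.induct)
  case (counts_halted c)
  then show ?case
    by (cases ts) (auto simp: run_Nil_iff run_Cons_iff halted_def)
next
  case (counts_step c k)
  show ?case
  proof (cases ts)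
    case Nil
    then show ?thesis
      using counts_step by (simp add: run_Nil_iff)
  next
    case (Cons t ts')
    then show ?thesis
      using counts_step.IH[of t ts'] counts_step.prems by (simp add: run_Cons_iff)
  qed
qed

lemma counts_no_infinite_run:
  assumes "counts M x b c k"
  shows "\<not> (\<exists>cs. cs 0 = c \<and>
    (\<forall>i::nat. \<exists>t. enabled M x (cs i) t \<and> cs (Suc i) = apply_transition x t (cs i)))"
  using assms
proof (induction rule: counts.induct)
  case (counts_halted c)
  then show ?case
    by (metis halted_def)
next
  case (counts_step c k)
  show ?case
  proof
    assume "\<exists>cs. cs 0 = c \<and>
      (\<forall>i::nat. \<exists>t. enabled M x (cs i) t \<and> cs (Suc i) = apply_transition x t (cs i))"
    then obtain cs where cs: "cs 0 = c"
      "\<And>i. \<exists>t. enabled M x (cs i) t \<and> cs (Suc i) = apply_transition x t (cs i)"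
      by blast
    obtain t where t: "enabled M x c t" "cs 1 = apply_transition x t c"
      using cs(2)[of 0] cs(1) by auto
    have "\<exists>ds. ds 0 = apply_transition x t c \<and>
      (\<forall>i::nat. \<exists>t. enabled M x (ds i) t \<and> ds (Suc i) = apply_transition x t (ds i))"
      by (rule exI[of _ "\<lambda>i. cs (Suc i)"]) (use cs(2) t in auto)
    then show False
      using counts_step.IH[OF t(1)] by blast
  qed
qed

lemma counts_card:
  assumes "finite (delta M)" "counts M x b c k"
  shows "finite {ts. \<exists>c'. run M x c ts c' \<and> halted M x c' \<and> state c' \<in> accepting M} \<and>
    card {ts. \<exists>c'. run M x c ts c' \<and> halted M x c' \<and> state c' \<in> accepting M} = k"
  using assms(2)
proof (induction rule: counts.induct)
  case (counts_halted c)
  have "{ts. \<exists>c'. run M x c ts c' \<and> halted M x c' \<and> state c' \<in> accepting M} =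
      (if state c \<in> accepting M then {[]} else {})"
  proof (rule set_eqI)
    fix ts
    show "ts \<in> {ts. \<exists>c'. run M x c ts c' \<and> halted M x c' \<and> state c' \<in> accepting M} \<longleftrightarrow>
        ts \<in> (if state c \<in> accepting M then {[]} else {})"
      using counts_halted by (cases ts) (auto simp: run_Nil_iff run_Cons_iff halted_def)
  qed
  then show ?case by simp
next
  case (counts_step c k)
  let ?A = "\<lambda>c. {ts. \<exists>c'. run M x c ts c' \<and> halted M x c' \<and> state c' \<in> accepting M}"
  let ?E = "{t. enabled M x c t}"
  have fin: "finite ?E"
    by (rule finite_subset[OF _ assms(1)]) (auto simp: enabled_def)
  have eq: "?A c = (\<Union>t\<in>?E. (#) t ` ?A (apply_transition x t c))"
  proof (rule set_eqI)
    fix ts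
    show "ts \<in> ?A c \<longleftrightarrow> ts \<in> (\<Union>t\<in>?E. (#) t ` ?A (apply_transition x t c))"
      using counts_step.hyps by (cases ts) (auto simp: run_Nil_iff run_Cons_iff)
  qed
  have "card (?A c) = (\<Sum>t\<in>?E. card ((#) t ` ?A (apply_transition x t c)))"
    unfolding eq by (rule card_UN_disjoint) (use fin counts_step.IH in auto)
  also have "\<dots> = (\<Sum>t\<in>?E. k t)"
    using counts_step.IH by (intro sum.cong) (auto simp: card_image)
  finally show ?case
    using fin counts_step.IH by (simp add: eq)
qed

section \<open>Counter programs\<close>

text \<open>
  The first argument of \<open>Inc\<close> and \<open>Dec\<close> is a register, all other numbers are
  addresses. \<open>Dec r p q\<close> decrements \<open>r\<close> and continues at \<open>p\<close> if \<open>r\<close>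
  is positive, and continues at \<open>q\<close> otherwise. \<open>Choose\<close> is the only nondeterministic
  instruction; its two addresses should be different, since otherwise there is a single transition
  only. \<open>Read p q e\<close> consumes an input letter and continues at \<open>p\<close> after a 1
  and at \<open>q\<close> after a 0; at the right end of the input it continues at \<open>e\<close>.
  \<open>Init\<close> sets up the tapes and is meant for address 0 only.
\<close>

datatype instr =
    Init nat
  | Inc nat nat
  | Dec nat nat nat
  | Choose nat nat
  | Read nat nat nat
  | Stop bool

text \<open>Write \<open>a\<close> on tape \<open>r\<close> and move its head; the other tapes, which show
  the symbols \<open>w\<close>, are left unchanged.\<close>

definition put :: "nat list \<Rightarrow> nat \<Rightarrow> nat \<Rightarrow> dir \<Rightarrow> (nat \<times> dir) list" where
  "put w r a d = (map (\<lambda>a. (a, Stay)) w)[r := (a, d)]"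

text \<open>
  A counter is written in binary from cell 1 on, least significant digit first; the symbols 1 and 2
  stand for the digits 0 and 1, cell 0 carries the mark 3, and the rest is blank. Leading zeros are
  allowed. Between two instructions all heads are in cell 1.

  The state is three times the address \<open>pc\<close> plus a phase \<open>ph\<close>. Phase 0 of
  \<open>Inc\<close> and \<open>Dec\<close> propagates the carry or the borrow to the right, and phase 1
  returns to the mark. A borrow that reaches the blank shows that the counter was zero; phase 2 then
  turns all the digits that were changed back into zeros on the way to the mark.

  The result consists of the possible next states, input head moves and work tape actions.
\<close>

fun instr_moves ::
    "instr \<Rightarrow> nat \<Rightarrow> nat \<Rightarrow> isym \<Rightarrow> nat list \<Rightarrow> (nat \<times> dir \<times> (nat \<times> dir) list) set" where
  "instr_moves (Init p) pc ph s w = {(3 * p, Rgt, map (\<lambda>_. (3, Rgt)) w)}"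
| "instr_moves (Inc r p) pc ph s w =
    (if ph = 0 then
       if w ! r = 2 then {(3 * pc, Stay, put w r 1 Rgt)}
       else {(3 * pc + 1, Stay, put w r 2 Lft)}
     else
       if w ! r = 3 then {(3 * p, Stay, put w r 3 Rgt)}
       else {(3 * pc + 1, Stay, put w r (w ! r) Lft)})"
| "instr_moves (Dec r p p0) pc ph s w =
    (if ph = 0 then
       if w ! r = 1 then {(3 * pc, Stay, put w r 2 Rgt)}
       else if w ! r = 2 then {(3 * pc + 1, Stay, put w r 1 Lft)}
       else {(3 * pc + 2, Stay, put w r 0 Lft)}
     else if ph = 1 then
       if w ! r = 3 then {(3 * p, Stay, put w r 3 Rgt)}
       else {(3 * pc + 1, Stay, put w r (w ! r) Lft)}
     else
       if w ! r = 3 then {(3 * p0, Stay, put w r 3 Rgt)}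
       else {(3 * pc + 2, Stay, put w r 1 Lft)})"
| "instr_moves (Choose p q) pc ph s w =
    (\<lambda>p. (3 * p, Stay, map (\<lambda>a. (a, Stay)) w)) ` {p, q}"
| "instr_moves (Read p q e) pc ph s w =
    {(case s of Bit True \<Rightarrow> 3 * p | Bit False \<Rightarrow> 3 * q | _ \<Rightarrow> 3 * e, Rgt,
      map (\<lambda>a. (a, Stay)) w)}"
| "instr_moves (Stop acc) pc ph s w = {}"

text \<open>The machine with \<open>k\<close> registers that runs \<open>prog\<close> from address 0.\<close>

definition counter_ntm :: "nat \<Rightarrow> instr list \<Rightarrow> ntm" where
  "counter_ntm k prog =
    \<lparr>ntapes = k,
     delta = {t. src t div 3 < length prog \<and> length (wread t) = k \<and> set (wread t) \<subseteq> {..3} \<and>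
       (dst t, imove t, wacts t) \<in>
         instr_moves (prog ! (src t div 3)) (src t div 3) (src t mod 3) (iread t) (wread t)},
     start = 0,
     accepting = {3 * pc | pc. pc < length prog \<and> prog ! pc = Stop True}\<rparr>"

lemma finite_instr_moves: "finite (instr_moves ins pc ph s w)"
  by (cases ins) auto

lemma length_instr_moves: "(q, m, a) \<in> instr_moves ins pc ph s w \<Longrightarrow> length a = length w"
  by (cases ins) (auto simp: put_def split: if_splits)

lemma finite_isym: "finite (UNIV :: isym set)"
proof -
  have "s \<in> {LeftEnd, Bit True, Bit False, RightEnd}" for s
    by (cases s) auto
  then have "UNIV = {LeftEnd, Bit True, Bit False, RightEnd}"
    by blast
  then show ?thesis
    by (metis finite.emptyI finite_insert)
qed

lemma wf_counter_ntm: "wf_ntm (counter_ntm k prog)"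
proof -
  let ?W = "{w. set w \<subseteq> {..3::nat} \<and> length w = k}"
  let ?I = "{..<3 * length prog} \<times> (UNIV :: isym set) \<times> ?W"
  have "delta (counter_ntm k prog) \<subseteq>
    (\<Union>(q, s, w)\<in>?I. (\<lambda>(q', m, a). \<lparr>src = q, iread = s, wread = w, dst = q', imove = m, wacts = a\<rparr>) `
        instr_moves (prog ! (q div 3)) (q div 3) (q mod 3) s w)" (is "_ \<subseteq> ?R")
  proof
    fix t assume "t \<in> delta (counter_ntm k prog)"
    then have t: "src t < 3 * length prog" "length (wread t) = k" "set (wread t) \<subseteq> {..3}"
      "(dst t, imove t, wacts t) \<in>
         instr_moves (prog ! (src t div 3)) (src t div 3) (src t mod 3) (iread t) (wread t)"
      by (auto simp: counter_ntm_def simp del: instr_moves.simps)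
    show "t \<in> ?R"
    proof (rule UN_I)
      show "(src t, iread t, wread t) \<in> ?I"
        using t by simp
      show "t \<in> (case (src t, iread t, wread t) of (q, s, w) \<Rightarrow>
          (\<lambda>(q', m, a). \<lparr>src = q, iread = s, wread = w, dst = q', imove = m, wacts = a\<rparr>) `
            instr_moves (prog ! (q div 3)) (q div 3) (q mod 3) s w)"
        using t(4) by (auto intro!: image_eqI)
    qed
  qed
  moreover have "finite ?R"
    by (intro finite_UN_I finite_cartesian_product finite_isym finite_lists_length_eq)
       (auto simp: finite_instr_moves)
  ultimately have "finite (delta (counter_ntm k prog))"
    by (rule finite_subset)
  then show ?thesis
    by (auto simp: wf_ntm_def counter_ntm_def dest: length_instr_moves)
qed

section \<open>Binary counters\<close>

text \<open>The value of a list of binary digits, least significant digit first.\<close>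

fun val :: "bool list \<Rightarrow> nat" where
  "val [] = 0"
| "val (d # ds) = of_bool d + 2 * val ds"

fun inc :: "bool list \<Rightarrow> bool list" where
  "inc [] = [True]"
| "inc (False # ds) = True # ds"
| "inc (True # ds) = False # inc ds"

fun dec :: "bool list \<Rightarrow> bool list" where
  "dec [] = []"
| "dec (True # ds) = False # ds"
| "dec (False # ds) = True # dec ds"

lemma val_inc: "val (inc ds) = Suc (val ds)"
  by (induction ds rule: inc.induct) auto

lemma val_dec: "val ds > 0 \<Longrightarrow> val (dec ds) = val ds - 1"
  by (induction ds rule: dec.induct) auto

lemma length_dec: "length (dec ds) = length ds"
  by (induction ds rule: dec.induct) auto

lemma length_inc: "length ds \<le> L \<Longrightarrow> Suc (val ds) < 2 ^ L \<Longrightarrow> length (inc ds) \<le> L"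
proof (induction ds arbitrary: L rule: inc.induct)
  case 1
  then show ?case by (cases L) auto
next
  case (3 ds)
  then show ?case by (cases L) auto
qed auto

lemma val_eq_0: "val ds = 0 \<Longrightarrow> ds = replicate (length ds) False"
  by (induction ds) auto

text \<open>The contents of the tape of a counter with the digits \<open>ds\<close>.\<close>

definition tape :: "bool list \<Rightarrow> nat \<Rightarrow> nat" where
  "tape ds p = (if p = 0 then 3 else if p \<le> length ds then if ds ! (p - 1) then 2 else 1 else 0)"

lemma tape_le: "tape ds p \<le> 3"
  by (simp add: tape_def)

lemma tape_0: "tape ds 0 = 3"
  by (simp add: tape_def)

lemma tape_not_mark: "p > 0 \<Longrightarrow> tape ds p \<noteq> 3"
  by (simp add: tape_def)

lemma tape_digit: "tape (us @ d # ds) (Suc (length us)) = (if d then 2 else 1)"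
  by (simp add: tape_def)

lemma tape_blank: "tape us (Suc (length us)) = 0"
  by (simp add: tape_def)

lemma tape_update:
  "(tape (us @ d # ds))(Suc (length us) := if e then 2 else 1) = tape (us @ e # ds)"
  by (rule ext) (auto simp: tape_def nth_append nth_Cons split: nat.split)

lemma tape_extend: "(tape us)(Suc (length us) := if e then 2 else 1) = tape (us @ [e])"
  by (rule ext) (auto simp: tape_def nth_append)

context
  fixes k :: nat and prog :: "instr list" and x :: "bool list" and L :: nat
begin

private abbreviation "M \<equiv> counter_ntm k prog"

private abbreviation cfg :: "nat \<Rightarrow> nat \<Rightarrow> ((nat \<Rightarrow> nat) \<times> nat) list \<Rightarrow> config" where
  "cfg q ip T \<equiv> \<lparr>state = q, ipos = ip, wtapes = T\<rparr>"

text \<open>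
  Here \<open>L\<close> bounds the number of digits of each counter. As a carry or a borrow may visit the
  blank cell behind the last digit, heads are in the cells up to \<open>L + 1\<close>.
\<close>

definition ok :: "((nat \<Rightarrow> nat) \<times> nat) list \<Rightarrow> bool" where
  "ok T \<longleftrightarrow> length T = k \<and> (\<forall>(f, h)\<in>set T. f h \<le> 3 \<and> h < L + 2)"

lemma enabled_counter_ntm:
  assumes "ok T" "q div 3 < length prog"
  shows "{t. enabled M x (cfg q ip T) t} =
    (\<lambda>(q', m, a). \<lparr>src = q, iread = input_symbol x ip, wread = map (\<lambda>(f, h). f h) T,
        dst = q', imove = m, wacts = a\<rparr>) `
      instr_moves (prog ! (q div 3)) (q div 3) (q mod 3) (input_symbol x ip) (map (\<lambda>(f, h). f h) T)"
    (is "?A = ?f ` ?B")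
proof
  show "?A \<subseteq> ?f ` ?B"
  proof
    fix t assume "t \<in> ?A"
    then show "t \<in> ?f ` ?B"
      by (cases t) (force simp: enabled_def counter_ntm_def)
  qed
  show "?f ` ?B \<subseteq> ?A"
    using assms by (auto simp: enabled_def counter_ntm_def ok_def)
qed

lemma counts_single:
  assumes "ok T" "q div 3 < length prog"
    and "instr_moves (prog ! (q div 3)) (q div 3) (q mod 3) (input_symbol x ip)
      (map (\<lambda>(f, h). f h) T) = {(q', m, a)}"
    and "counts M x (L + 2) (cfg q' (min (length x + 1) (move m ip))
      (map2 (\<lambda>(a, d) (f, h). (f(h := a), move d h)) a T)) n"
  shows "counts M x (L + 2) (cfg q ip T) n"
proof -
  let ?t = "\<lparr>src = q, iread = input_symbol x ip, wread = map (\<lambda>(f, h). f h) T,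
        dst = q', imove = m, wacts = a\<rparr>"
  have E: "{t. enabled M x (cfg q ip T) t} = {?t}"
    using enabled_counter_ntm[OF assms(1,2), of ip] assms(3) by simp
  have "counts M x (L + 2) (cfg q ip T) (\<Sum>t | enabled M x (cfg q ip T) t. n)"
  proof (rule counts_step)
    show "\<forall>(f, h)\<in>set (wtapes (cfg q ip T)). h < L + 2"
      using assms(1) by (auto simp: ok_def)
    show "\<not> halted M x (cfg q ip T)"
      using E by (auto simp: halted_def)
    fix t assume "enabled M x (cfg q ip T) t"
    then have "t = ?t" using E by blast
    then show "counts M x (L + 2) (apply_transition x t (cfg q ip T)) n"
      using assms(4) by (simp add: apply_transition_def)
  qed
  then show ?thesis by (simp add: E)
qed

lemma map2_keep: "map2 (\<lambda>(a, d) (f, h). (f(h := a), move d h))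
    (map (\<lambda>a. (a, Stay)) (map (\<lambda>(f, h). f h) T)) T = T"
  by (rule nth_equalityI) (auto split: prod.splits)

lemma map2_put:
  assumes "r < length T" "T ! r = (f, h)"
  shows "map2 (\<lambda>(a, d) (f, h). (f(h := a), move d h)) (put (map (\<lambda>(f, h). f h) T) r a d) T =
    T[r := (f(h := a), move d h)]"
  using assms by (intro nth_equalityI) (auto simp: put_def nth_list_update split: prod.splits)

lemma counts_put:
  assumes "ok (T[r := (f, h)])" "r < k" "q div 3 < length prog" "ip \<le> length x + 1"
    and "instr_moves (prog ! (q div 3)) (q div 3) (q mod 3) (input_symbol x ip)
      (map (\<lambda>(f, h). f h) (T[r := (f, h)])) =
        {(q', Stay, put (map (\<lambda>(f, h). f h) (T[r := (f, h)])) r a d)}"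
    and "counts M x (L + 2) (cfg q' ip (T[r := (f(h := a), move d h)])) n"
  shows "counts M x (L + 2) (cfg q ip (T[r := (f, h)])) n"
proof (rule counts_single[OF assms(1,3,5)])
  have "length T = k" using assms(1) by (simp add: ok_def)
  then show "counts M x (L + 2) (cfg q' (min (length x + 1) (move Stay ip))
      (map2 (\<lambda>(a, d) (f, h). (f(h := a), move d h))
        (put (map (\<lambda>(f, h). f h) (T[r := (f, h)])) r a d) (T[r := (f, h)]))) n"
    using assms(2,4,6) by (subst map2_put[where f = f and h = h]) (auto simp: min_absorb2)
qed

lemma ok_update:
  "ok T \<Longrightarrow> f h \<le> 3 \<Longrightarrow> h < L + 2 \<Longrightarrow> ok (T[r := (f, h)])"
  unfolding ok_def by (auto dest!: set_update_subset_insert[THEN subsetD])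

lemma div_mod_3:
  "(3 * pc) div 3 = pc" "(3 * pc + 1) div 3 = pc" "(3 * pc + 2) div 3 = pc"
  "(3 * pc) mod 3 = 0" "(3 * pc + 1) mod 3 = 1" "(3 * pc + 2) mod 3 = (2::nat)"
  "Suc (3 * pc) div 3 = pc" "Suc (Suc (3 * pc)) div 3 = pc"
  "Suc (3 * pc) mod 3 = 1" "Suc (Suc (3 * pc)) mod 3 = 2"
  by presburger+

lemma ok_rest:
  "length dss = k \<Longrightarrow> ok (map (\<lambda>ds. (tape ds, 1)) dss)"
  by (auto simp: ok_def tape_le)

text \<open>Phase 1 takes the head back to cell 1 without changing the tape.\<close>

lemma counts_return:
  assumes "ok T" "r < k" "pc < length prog" "ip \<le> length x + 1"
    and "prog ! pc = Inc r p \<or> prog ! pc = Dec r p p0"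
    and "counts M x (L + 2) (cfg (3 * p) ip (T[r := (tape ds, 1)])) n"
  shows "h < L + 2 \<Longrightarrow> counts M x (L + 2) (cfg (3 * pc + 1) ip (T[r := (tape ds, h)])) n"
proof (induction h)
  case 0
  have *: "(tape ds)(0 := 3) = tape ds"
    by (auto simp: tape_0)
  show ?case
    by (rule counts_put[where q' = "3 * p" and a = 3 and d = Rgt])
      (use * assms in \<open>auto simp: ok_update tape_le div_mod_3 ok_def[of T] tape_0\<close>)
next
  case (Suc h)
  have *: "tape ds (Suc h) \<noteq> 3"
    by (simp add: tape_not_mark)
  show ?case
    by (rule counts_put[where q' = "3 * pc + 1" and a = "tape ds (Suc h)" and d = Lft])
      (use * assms(1-5) Suc in \<open>auto simp: ok_update tape_le div_mod_3 ok_def[of T]\<close>)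
qed

text \<open>
  In the next two lemmas \<open>us\<close> are the digits that the head has already passed; it is
  irrelevant for the rest of the computation what they are.
\<close>

lemma counts_inc:
  assumes "ok T" "r < k" "pc < length prog" "ip \<le> length x + 1" "prog ! pc = Inc r p"
  shows "length (us @ ds) \<le> L \<Longrightarrow>
    counts M x (L + 2) (cfg (3 * p) ip (T[r := (tape (us @ inc ds), 1)])) n \<Longrightarrow>
    counts M x (L + 2) (cfg (3 * pc) ip (T[r := (tape (us @ ds), Suc (length us))])) n"
proof (induction ds arbitrary: us rule: inc.induct)
  case 1
  have *: "counts M x (L + 2) (cfg (3 * pc + 1) ip (T[r := (tape (us @ [True]), length us)])) n"
    by (rule counts_return) (use assms 1 in auto)
  show ?case
    by (rule counts_put[where q' = "3 * pc + 1" and a = 2 and d = Lft])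
      (use * assms 1 tape_extend[of us True]
        in \<open>auto simp: ok_update tape_le div_mod_3 ok_def[of T] tape_blank\<close>)
next
  case (2 ds)
  have *: "counts M x (L + 2) (cfg (3 * pc + 1) ip (T[r := (tape (us @ True # ds), length us)])) n"
    by (rule counts_return) (use assms 2 in auto)
  show ?case
    by (rule counts_put[where q' = "3 * pc + 1" and a = 2 and d = Lft])
      (use * assms 2 tape_update[of us False ds True]
        in \<open>auto simp: ok_update tape_le div_mod_3 ok_def[of T] tape_digit\<close>)
next
  case (3 ds)
  have *: "counts M x (L + 2) (cfg (3 * pc) ip
      (T[r := (tape ((us @ [False]) @ ds), Suc (length (us @ [False])))])) n"
    by (rule "3.IH") (use 3(2,3) in auto)
  show ?case
    by (rule counts_put[where q' = "3 * pc" and a = 1 and d = Rgt])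
      (use * assms 3(2) tape_update[of us True ds False]
        in \<open>auto simp: ok_update tape_le div_mod_3 ok_def[of T] tape_digit\<close>)
qed

lemma counts_dec:
  assumes "ok T" "r < k" "pc < length prog" "ip \<le> length x + 1" "prog ! pc = Dec r p p0"
  shows "length (us @ ds) \<le> L \<Longrightarrow> val ds > 0 \<Longrightarrow>
    counts M x (L + 2) (cfg (3 * p) ip (T[r := (tape (us @ dec ds), 1)])) n \<Longrightarrow>
    counts M x (L + 2) (cfg (3 * pc) ip (T[r := (tape (us @ ds), Suc (length us))])) n"
proof (induction ds arbitrary: us rule: dec.induct)
  case (2 ds)
  have *: "counts M x (L + 2) (cfg (3 * pc + 1) ip (T[r := (tape (us @ False # ds), length us)])) n"
    by (rule counts_return) (use assms 2 in auto)
  show ?case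
    by (rule counts_put[where q' = "3 * pc + 1" and a = 1 and d = Lft])
      (use * assms 2 tape_update[of us True ds False]
        in \<open>auto simp: ok_update tape_le div_mod_3 ok_def[of T] tape_digit\<close>)
next
  case (3 ds)
  have *: "counts M x (L + 2) (cfg (3 * pc) ip
      (T[r := (tape ((us @ [True]) @ ds), Suc (length (us @ [True])))])) n"
    by (rule "3.IH") (use 3(2,3,4) in auto)
  show ?case
    by (rule counts_put[where q' = "3 * pc" and a = 2 and d = Rgt])
      (use * assms 3(2) tape_update[of us False ds True]
        in \<open>auto simp: ok_update tape_le div_mod_3 ok_def[of T] tape_digit\<close>)
qed auto

text \<open>
  Phase 2, with \<open>j\<close> digits left to be reset; these have been changed to ones by phase 0.
\<close>

lemma counts_undo_borrow:
  assumes "ok T" "r < k" "pc < length prog" "ip \<le> length x + 1" "prog ! pc = Dec r p p0"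
  shows "length (us @ ds) \<le> L \<Longrightarrow> us = replicate j True \<Longrightarrow>
    counts M x (L + 2) (cfg (3 * p0) ip (T[r := (tape (replicate j False @ ds), 1)])) n \<Longrightarrow>
    counts M x (L + 2) (cfg (3 * pc + 2) ip (T[r := (tape (us @ ds), j)])) n"
proof (induction j arbitrary: us ds)
  case 0
  have *: "(tape ds)(0 := 3) = tape ds"
    by (auto simp: tape_0)
  show ?case
    by (rule counts_put[where q' = "3 * p0" and a = 3 and d = Rgt])
      (use * assms 0 in \<open>auto simp: ok_update tape_le div_mod_3 ok_def[of T] tape_0\<close>)
next
  case (Suc j)
  have us: "us @ ds = replicate j True @ True # ds"
    using Suc.prems(2) by (simp add: replicate_app_Cons_same)
  have *: "counts M x (L + 2) (cfg (3 * pc + 2) ip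
      (T[r := (tape (replicate j True @ False # ds), j)])) n"
    by (rule Suc.IH)
      (use Suc.prems in \<open>auto simp: replicate_app_Cons_same\<close>)
  show ?case
    unfolding us
    by (rule counts_put[where q' = "3 * pc + 2" and a = 1 and d = Lft])
      (use * assms Suc.prems(1) us tape_update[of "replicate j True" True ds False]
          tape_digit[of "replicate j True" True ds]
        in \<open>auto simp: ok_update tape_le div_mod_3 ok_def[of T]\<close>)
qed

lemma counts_dec_zero:
  assumes "ok T" "r < k" "pc < length prog" "ip \<le> length x + 1" "prog ! pc = Dec r p p0"
    and "counts M x (L + 2) (cfg (3 * p0) ip (T[r := (tape (replicate (j + m) False), 1)])) n"
  shows "j + m \<le> L \<Longrightarrow> counts M x (L + 2) (cfg (3 * pc) ip
      (T[r := (tape (replicate j True @ replicate m False), Suc j)])) n"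
  using assms(6)
proof (induction m arbitrary: j)
  case 0
  have *: "counts M x (L + 2) (cfg (3 * pc + 2) ip (T[r := (tape (replicate j True @ []), j)])) n"
    by (rule counts_undo_borrow) (use assms(1-5) 0 in auto)
  have blank: "tape (replicate j True) (Suc j) = 0"
    using tape_blank[of "replicate j True"] by simp
  from blank have keep: "(tape (replicate j True))(Suc j := 0) = tape (replicate j True)"
    by auto
  show ?case
    by (rule counts_put[where q' = "3 * pc + 2" and a = 0 and d = Lft])
      (use assms(1-5) 0 * blank keep in \<open>auto simp: ok_update tape_le div_mod_3 ok_def[of T]\<close>)
next
  case (Suc m)
  have *: "counts M x (L + 2) (cfg (3 * pc) ip
      (T[r := (tape (replicate (Suc j) True @ replicate m False), Suc (Suc j))])) n"
    by (rule Suc.IH) (use Suc.prems in auto)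
  show ?case
    by (rule counts_put[where q' = "3 * pc" and a = 2 and d = Rgt])
      (use * assms(1-5) Suc.prems(1)
          tape_update[of "replicate j True" False "replicate m False" True]
          tape_digit[of "replicate j True" False "replicate m False"]
        in \<open>auto simp: ok_update tape_le div_mod_3 ok_def[of T] replicate_app_Cons_same\<close>)
qed

section \<open>Rules for counter programs\<close>

text \<open>
  \<open>from_counts pc p vs n\<close>: started at address \<open>pc\<close> with \<open>p\<close> input letters
  consumed and register contents \<open>vs\<close>, the program has \<open>n\<close> accepting paths. The binary
  representation of the registers is arbitrary as long as it has at most \<open>L\<close> digits. The
  head position is \<open>Suc p\<close> because of the left end marker.
\<close>

definition from_counts :: "nat \<Rightarrow> nat \<Rightarrow> nat list \<Rightarrow> nat \<Rightarrow> bool" where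
  "from_counts pc p vs n \<longleftrightarrow> (\<forall>dss. map val dss = vs \<longrightarrow> (\<forall>ds\<in>set dss. length ds \<le> L) \<longrightarrow>
     counts M x (L + 2) (cfg (3 * pc) (Suc p) (map (\<lambda>ds. (tape ds, 1)) dss)) n)"

lemma short_update:
  "\<forall>ds\<in>set dss. length ds \<le> L \<Longrightarrow> length es \<le> L \<Longrightarrow>
    \<forall>ds\<in>set (dss[r := es]). length ds \<le> L"
  using set_update_subset_insert[of dss r es] by blast

lemma map_tape_update:
  "r < length dss \<Longrightarrow> (map (\<lambda>ds. (tape ds, 1::nat)) dss)[r := (tape (dss ! r), 1)] =
     map (\<lambda>ds. (tape ds, 1)) dss"
  by (metis (no_types, lifting) length_map list_update_id nth_map)

lemma from_counts_D:
  "from_counts pc p vs n \<Longrightarrow> map val dss = vs \<Longrightarrow> \<forall>ds\<in>set dss. length ds \<le> L \<Longrightarrow>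
    counts M x (L + 2) (cfg (3 * pc) (Suc p) (map (\<lambda>ds. (tape ds, 1)) dss)) n"
  by (simp add: from_counts_def)

lemma from_counts_Inc:
  assumes "from_counts p' p (vs[r := Suc (vs ! r)]) n"
    and "prog ! pc = Inc r p'" "pc < length prog" "length vs = k" "r < k" "p \<le> length x"
    and "Suc (vs ! r) < 2 ^ L"
  shows "from_counts pc p vs n"
  unfolding from_counts_def
proof (intro allI impI)
  fix dss assume dss: "map val dss = vs" "\<forall>ds\<in>set dss. length ds \<le> L"
  let ?T = "map (\<lambda>ds. (tape ds, 1::nat)) dss"
  have len: "length dss = k" using dss assms(4) by auto
  have v: "vs ! r = val (dss ! r)" using dss len assms(5) by auto
  have lr: "length (dss ! r) \<le> L" using dss len assms(5) by auto
  have li: "length (inc (dss ! r)) \<le> L" using lr assms(7) v by (simp add: length_inc)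
  have *: "counts M x (L + 2) (cfg (3 * p') (Suc p)
      (map (\<lambda>ds. (tape ds, 1)) (dss[r := inc (dss ! r)]))) n"
    by (rule from_counts_D[OF assms(1) _ short_update[OF dss(2)]])
      (use dss li v in \<open>auto simp: map_update val_inc\<close>)
  have "counts M x (L + 2) (cfg (3 * pc) (Suc p)
      (?T[r := (tape ([] @ (dss ! r)), Suc (length ([]::bool list)))])) n"
    by (rule counts_inc[OF ok_rest[OF len]]) (use * assms lr in \<open>auto simp: map_update\<close>)
  then show "counts M x (L + 2) (cfg (3 * pc) (Suc p) ?T) n"
    using map_tape_update[of r dss] len assms(5) by simp
qed

lemma from_counts_Dec:
  assumes "from_counts p' p (vs[r := vs ! r - 1]) n"
    and "prog ! pc = Dec r p' q" "pc < length prog" "length vs = k" "r < k" "p \<le> length x"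
    and "vs ! r > 0"
  shows "from_counts pc p vs n"
  unfolding from_counts_def
proof (intro allI impI)
  fix dss assume dss: "map val dss = vs" "\<forall>ds\<in>set dss. length ds \<le> L"
  let ?T = "map (\<lambda>ds. (tape ds, 1::nat)) dss"
  have len: "length dss = k" using dss assms(4) by auto
  have v: "vs ! r = val (dss ! r)" using dss len assms(5) by auto
  have lr: "length (dss ! r) \<le> L" using dss len assms(5) by auto
  have *: "counts M x (L + 2) (cfg (3 * p') (Suc p)
      (map (\<lambda>ds. (tape ds, 1)) (dss[r := dec (dss ! r)]))) n"
    by (rule from_counts_D[OF assms(1) _ short_update[OF dss(2)]])
      (use assms(7) dss lr v in \<open>auto simp: map_update val_dec length_dec\<close>)
  have "counts M x (L + 2) (cfg (3 * pc) (Suc p)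
      (?T[r := (tape ([] @ (dss ! r)), Suc (length ([]::bool list)))])) n"
    by (rule counts_dec[OF ok_rest[OF len]]) (use * assms lr v in \<open>auto simp: map_update\<close>)
  then show "counts M x (L + 2) (cfg (3 * pc) (Suc p) ?T) n"
    using map_tape_update[of r dss] len assms(5) by simp
qed

lemma from_counts_Dec_zero:
  assumes "from_counts q p vs n"
    and "prog ! pc = Dec r p' q" "pc < length prog" "length vs = k" "r < k" "p \<le> length x"
    and "vs ! r = 0"
  shows "from_counts pc p vs n"
  unfolding from_counts_def
proof (intro allI impI)
  fix dss assume dss: "map val dss = vs" "\<forall>ds\<in>set dss. length ds \<le> L"
  let ?T = "map (\<lambda>ds. (tape ds, 1::nat)) dss"
  have len: "length dss = k" using dss assms(4) by auto
  have v: "val (dss ! r) = 0" using dss len assms(5,7) by auto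
  have lr: "length (dss ! r) \<le> L" using dss len assms(5) by auto
  have T: "?T[r := (tape (replicate (length (dss ! r)) False), 1)] = ?T"
    unfolding val_eq_0[OF v, symmetric] by (rule map_tape_update) (use len assms(5) in simp)
  have *: "counts M x (L + 2) (cfg (3 * q) (Suc p) ?T) n"
    by (rule from_counts_D[OF assms(1) dss])
  have "counts M x (L + 2) (cfg (3 * pc) (Suc p)
      (?T[r := (tape (replicate 0 True @ replicate (length (dss ! r)) False), Suc 0)])) n"
    by (rule counts_dec_zero[OF ok_rest[OF len]]) (use * assms lr T in auto)
  then show "counts M x (L + 2) (cfg (3 * pc) (Suc p) ?T) n"
    using T by simp
qed

lemma from_counts_Choose:
  assumes "from_counts q p vs n1" "from_counts q' p vs n2"
    and "prog ! pc = Choose q q'" "q \<noteq> q'" "pc < length prog" "length vs = k" "p \<le> length x"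
  shows "from_counts pc p vs (n1 + n2)"
  unfolding from_counts_def
proof (intro allI impI)
  fix dss assume dss: "map val dss = vs" "\<forall>ds\<in>set dss. length ds \<le> L"
  let ?T = "map (\<lambda>ds. (tape ds, 1::nat)) dss" and ?s = "3 * pc"
  have ok: "ok ?T" by (rule ok_rest) (use dss assms(6) in auto)
  let ?t = "\<lambda>p'. \<lparr>src = ?s, iread = input_symbol x (Suc p), wread = map (\<lambda>(f, h). f h) ?T,
    dst = 3 * p', imove = Stay, wacts = map (\<lambda>a. (a, Stay)) (map (\<lambda>(f, h). f h) ?T)\<rparr>"
  let ?n = "\<lambda>t. if dst t = 3 * q then n1 else n2"
  have E: "{t. enabled M x (cfg ?s (Suc p) ?T) t} = {?t q, ?t q'}"
    using enabled_counter_ntm[OF ok, of ?s "Suc p"] assms(3,5) by (simp add: div_mod_3)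
  have "counts M x (L + 2) (cfg ?s (Suc p) ?T) (\<Sum>t | enabled M x (cfg ?s (Suc p) ?T) t. ?n t)"
  proof (rule counts_step)
    show "\<forall>(f, h)\<in>set (wtapes (cfg ?s (Suc p) ?T)). h < L + 2"
      using ok by (auto simp: ok_def)
    show "\<not> halted M x (cfg ?s (Suc p) ?T)"
      using E by (auto simp: halted_def)
    fix t assume "enabled M x (cfg ?s (Suc p) ?T) t"
    then have t: "t = ?t q \<or> t = ?t q'" using E by blast
    have "apply_transition x (?t p') (cfg ?s (Suc p) ?T) = cfg (3 * p') (Suc p) ?T" for p'
      using assms(7) map2_keep[of ?T] by (simp add: apply_transition_def min_absorb2)
    moreover have "counts M x (L + 2) (cfg (3 * q) (Suc p) ?T) n1"
      "counts M x (L + 2) (cfg (3 * q') (Suc p) ?T) n2"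
      using assms(1,2) dss by (auto simp: from_counts_def)
    ultimately show "counts M x (L + 2) (apply_transition x t (cfg ?s (Suc p) ?T)) (?n t)"
      using t assms(4) by auto
  qed
  then show "counts M x (L + 2) (cfg ?s (Suc p) ?T) (n1 + n2)"
    unfolding E using assms(4) by simp
qed

lemma from_counts_Read:
  assumes "from_counts (if b then q else q') (Suc p) vs n"
    and "prog ! pc = Read q q' e" "pc < length prog" "length vs = k" "drop p x = b # xs"
  shows "from_counts pc p vs n"
  unfolding from_counts_def
proof (intro allI impI)
  fix dss assume dss: "map val dss = vs" "\<forall>ds\<in>set dss. length ds \<le> L"
  let ?T = "map (\<lambda>ds. (tape ds, 1::nat)) dss"
  have ok: "ok ?T" by (rule ok_rest) (use dss assms(4) in auto)
  have p: "p < length x" using assms(5) by (metis drop_all linorder_not_le list.distinct(1))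
  have b: "x ! p = b" using assms(5) p by (metis Cons_nth_drop_Suc list.inject)
  have s: "input_symbol x (Suc p) = Bit b"
    using p b by (simp add: input_symbol_def)
  show "counts M x (L + 2) (cfg (3 * pc) (Suc p) ?T) n"
    using ok
  proof (rule counts_single)
    show "instr_moves (prog ! (3 * pc div 3)) (3 * pc div 3) (3 * pc mod 3)
        (input_symbol x (Suc p)) (map (\<lambda>(f, h). f h) ?T) =
      {(3 * (if b then q else q'), Rgt, map (\<lambda>a. (a, Stay)) (map (\<lambda>(f, h). f h) ?T))}"
      using assms(2) s by (simp add: div_mod_3)
    show "counts M x (L + 2) (cfg (3 * (if b then q else q'))
        (min (length x + 1) (move Rgt (Suc p)))
        (map2 (\<lambda>(a, d) (f, h). (f(h := a), move d h))
          (map (\<lambda>a. (a, Stay)) (map (\<lambda>(f, h). f h) ?T)) ?T)) n"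
      unfolding map2_keep using assms(1) dss p by (auto simp: from_counts_def min_absorb2)
  qed (use assms(3) in \<open>simp add: div_mod_3\<close>)
qed

lemma from_counts_Read_end:
  assumes "from_counts e p vs n"
    and "prog ! pc = Read q q' e" "pc < length prog" "length vs = k" "p = length x"
  shows "from_counts pc p vs n"
  unfolding from_counts_def
proof (intro allI impI)
  fix dss assume dss: "map val dss = vs" "\<forall>ds\<in>set dss. length ds \<le> L"
  let ?T = "map (\<lambda>ds. (tape ds, 1::nat)) dss"
  have ok: "ok ?T" by (rule ok_rest) (use dss assms(4) in auto)
  have s: "input_symbol x (Suc p) = RightEnd"
    using assms(5) by (simp add: input_symbol_def)
  show "counts M x (L + 2) (cfg (3 * pc) (Suc p) ?T) n"
    using ok
  proof (rule counts_single)
    show "instr_moves (prog ! (3 * pc div 3)) (3 * pc div 3) (3 * pc mod 3)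
        (input_symbol x (Suc p)) (map (\<lambda>(f, h). f h) ?T) =
      {(3 * e, Rgt, map (\<lambda>a. (a, Stay)) (map (\<lambda>(f, h). f h) ?T))}"
      using assms(2) s by (simp add: div_mod_3)
    show "counts M x (L + 2) (cfg (3 * e)
        (min (length x + 1) (move Rgt (Suc p)))
        (map2 (\<lambda>(a, d) (f, h). (f(h := a), move d h))
          (map (\<lambda>a. (a, Stay)) (map (\<lambda>(f, h). f h) ?T)) ?T)) n"
      unfolding map2_keep using assms(5,1) dss by (auto simp: from_counts_def)
  qed (use assms(3) in \<open>simp add: div_mod_3\<close>)
qed

lemma from_counts_Stop:
  assumes "prog ! pc = Stop acc" "pc < length prog" "length vs = k"
  shows "from_counts pc p vs (of_bool acc)"
  unfolding from_counts_def
proof (intro allI impI)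
  fix dss assume dss: "map val dss = vs" "\<forall>ds\<in>set dss. length ds \<le> L"
  let ?c = "cfg (3 * pc) (Suc p) (map (\<lambda>ds. (tape ds, 1)) dss)"
  have ok: "ok (wtapes ?c)" unfolding config.simps by (rule ok_rest) (use dss assms(3) in auto)
  have "{t. enabled M x ?c t} = {}"
    using enabled_counter_ntm[of "wtapes ?c" "3 * pc" "Suc p"] ok assms(1,2)
    by (simp add: div_mod_3)
  then have *: "halted M x ?c" by (simp add: halted_def)
  have "counts M x (L + 2) ?c (if state ?c \<in> accepting M then 1 else 0)"
    by (rule counts_halted)
      (use * ok in \<open>auto simp: ok_def\<close>)
  then show "counts M x (L + 2) ?c (of_bool acc)"
    using assms by (cases acc) (auto simp: counter_ntm_def)
qed

lemma counts_init:
  assumes "prog ! 0 = Init p" "prog \<noteq> []" "from_counts p 0 (replicate k 0) n"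
  shows "counts M x (L + 2) (init_config M) n"
proof -
  let ?T = "replicate k (\<lambda>_. 0, 0) :: ((nat \<Rightarrow> nat) \<times> nat) list"
  have ok: "ok ?T" by (auto simp: ok_def)
  have "(\<lambda>_. 0)(0 := 3) = tape []"
    by (auto simp: tape_def)
  then have T: "map2 (\<lambda>(a, d) (f, h). (f(h := a), move d h))
      (map (\<lambda>_. (3, Rgt)) (map (\<lambda>(f, h). f h) ?T)) ?T = map (\<lambda>ds. (tape ds, 1)) (replicate k [])"
    by (intro nth_equalityI) auto
  have "counts M x (L + 2) (cfg 0 0 ?T) n"
    using ok
  proof (rule counts_single)
    show "instr_moves (prog ! (0 div 3)) (0 div 3) (0 mod 3) (input_symbol x 0)
        (map (\<lambda>(f, h). f h) ?T) = {(3 * p, Rgt, map (\<lambda>_. (3, Rgt)) (map (\<lambda>(f, h). f h) ?T))}"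
      using assms(1) by simp
    show "counts M x (L + 2) (cfg (3 * p) (min (length x + 1) (move Rgt 0))
      (map2 (\<lambda>(a, d) (f, h). (f(h := a), move d h))
        (map (\<lambda>_. (3, Rgt)) (map (\<lambda>(f, h). f h) ?T)) ?T)) n"
      unfolding T using assms(3)[unfolded from_counts_def, rule_format, of "replicate k []"] by simp
  qed (use assms(2) in simp)
  then show ?thesis
    by (simp add: init_config_def counter_ntm_def)
qed

end

section \<open>A program for counting permutations of a cycle type\<close>

text \<open>
  The registers are called $d, e, t, z, y, u$, in this order. Between letters, $d$ is the current
  cycle length $i$, $t$ is $i$ times the number of letters 1 consumed in the current block,
  $z + y$ is the total size of the earlier blocks, and $e = u = 0$. The addresses are used as
  follows.

  \<^item> 1: read a letter; accept at the end of the input.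
  \<^item> 2--4 and 8: the loop that is run $i$ times for a letter 1. It moves a unit from $d$ to $e$ and
    increments $t$.
  \<^item> 5--7: inside this loop, lower $z$ by a guessed amount, which is added to $y$; guesses beyond
    $z$ are rejected.
  \<^item> 9--15: unless $d = 0$, that is, unless $t$ is a multiple of $i$, choose one of $t$ units:
    $t$ is moved to $u$, where the choice is made by passing from the loop 9--11 to the loop 12--13,
    and then back. If no unit is chosen before $t$ runs out, reject.
  \<^item> 16--17: after the loop, move $e$ back to $d$.
  \<^item> 18--22: after a letter 0, add $y$ and $t$ to $z$ and increment $d$. The computation starts
    at address 22, which makes $d = 1$.
  \<^item> 23 and 24: accept and reject.
\<close>

definition cycle_prog :: "instr list" where
  "cycle_prog =
    [Init 22,
     Read 2 18 23,
     Dec 0 3 24, Inc 1 4, Inc 2 5,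
     Choose 6 8, Dec 3 7 24, Inc 4 5,
     Dec 0 9 16,
     Dec 2 10 24, Inc 5 11, Choose 9 12, Dec 2 13 14, Inc 5 12, Dec 5 15 3, Inc 2 14,
     Dec 1 17 1, Inc 0 16,
     Dec 4 19 20, Inc 3 18, Dec 2 21 22, Inc 3 20, Inc 0 1,
     Stop True, Stop False]"

context
  fixes x :: "bool list" and L :: nat
begin

abbreviation C :: "nat \<Rightarrow> nat \<Rightarrow> nat list \<Rightarrow> nat \<Rightarrow> bool" where
  "C \<equiv> from_counts 6 cycle_prog x L"

lemmas cycle_Inc = from_counts_Inc[where k = 6 and prog = cycle_prog and x = x and L = L]
lemmas cycle_Dec = from_counts_Dec[where k = 6 and prog = cycle_prog and x = x and L = L]
lemmas cycle_Dec_zero = from_counts_Dec_zero[where k = 6 and prog = cycle_prog and x = x and L = L]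
lemmas cycle_Choose = from_counts_Choose[where k = 6 and prog = cycle_prog and x = x and L = L]

lemma list_update_numeral [simp]:
  "(a # as)[numeral v := b] = a # as[pred_numeral v := b]"
  by (simp add: numeral_eq_Suc)

lemma length_cycle_prog: "length cycle_prog = 25"
  by (simp add: cycle_prog_def)

text \<open>A loop that moves the contents of register \<open>r\<close> to register \<open>r'\<close>.\<close>

lemma cycle_move_aux:
  assumes "cycle_prog ! pc = Dec r pc' q" "cycle_prog ! pc' = Inc r' pc" "pc < 25" "pc' < 25"
    "r < 6" "r' < 6" "r \<noteq> r'" "p \<le> length x"
  shows "vs ! r = a \<Longrightarrow> length vs = 6 \<Longrightarrow> a + vs ! r' < 2 ^ L \<Longrightarrow>
    C q p (vs[r := 0, r' := a + vs ! r']) n \<Longrightarrow> C pc p vs n"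
proof (induction a arbitrary: vs)
  case 0
  have "vs[r := 0, r' := 0 + vs ! r'] = vs"
    using list_update_id[of vs r] list_update_id[of vs r'] 0(1) by simp
  with 0(4) have *: "C q p vs n" by simp
  show ?case
    by (rule cycle_Dec_zero[where r = r and q = q and p' = pc', OF *])
      (use 0(1,2) assms in \<open>simp_all add: length_cycle_prog\<close>)
next
  case (Suc a)
  let ?vs = "vs[r := a, r' := Suc (vs ! r')]"
  have eq: "vs[r := 0, r' := Suc a + vs ! r'] = ?vs[r := 0, r' := a + ?vs ! r']"
    using assms(5-7) Suc.prems(2) by (intro nth_equalityI) (auto simp: nth_list_update)
  have *: "C pc p ?vs n"
    by (rule Suc.IH)
      (use assms(5-7) Suc.prems(2,3) Suc.prems(4)[unfolded eq] in simp_all)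
  have **: "C pc' p (vs[r := vs ! r - 1]) n"
    by (rule cycle_Inc[where r = r' and p' = pc])
      (use Suc.prems(1-3) assms * in \<open>simp_all add: length_cycle_prog\<close>)
  show ?case
    by (rule cycle_Dec[where r = r and p' = pc' and q = q, OF **])
      (use Suc.prems(1,2) assms in \<open>simp_all add: length_cycle_prog\<close>)
qed

lemmas cycle_move = cycle_move_aux[OF _ _ _ _ _ _ _ _ refl]

lemma cycle_reject: "C 24 p [d, e, t, z, y, u] 0"
  using from_counts_Stop[of cycle_prog 24 False "[d, e, t, z, y, u]" 6 x L p]
  by (simp add: cycle_prog_def)

text \<open>
  There are as many ways to choose a unit as there are units left in $t$, and all of them lead to
  the same registers at address 3; $u$ units have been passed over already.
\<close>

lemma cycle_multiply:
  assumes "p \<le> length x"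
  shows "t + u < 2 ^ L \<Longrightarrow> C 3 p [d, e, t + u, z, y, 0] n \<Longrightarrow> C 9 p [d, e, t, z, y, u] (t * n)"
proof (induction t arbitrary: u)
  case 0
  have "C 9 p [d, e, 0, z, y, u] 0"
    by (rule cycle_Dec_zero[where r = 2 and p' = 10 and q = 24])
      (use assms cycle_reject in \<open>auto simp: cycle_prog_def\<close>)
  then show ?case by simp
next
  case (Suc t)
  have left: "C 9 p [d, e, t, z, y, Suc u] (t * n)"
    using Suc by (intro Suc.IH) auto
  have *: "C 14 p [d, e, 0, z, y, Suc u + t] n"
    by (rule cycle_move[where r = 5 and r' = 2 and pc' = 15 and q = 3])
      (use assms Suc in \<open>auto simp: cycle_prog_def add.commute\<close>)
  have **: "C 12 p [d, e, t, z, y, Suc u] n"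
    by (rule cycle_move[where r = 2 and r' = 5 and pc' = 13 and q = 14])
      (use * assms Suc in \<open>auto simp: cycle_prog_def add.commute\<close>)
  have *: "C 11 p [d, e, t, z, y, Suc u] (t * n + n)"
    by (rule cycle_Choose[OF left **]) (use assms in \<open>auto simp: cycle_prog_def\<close>)
  have *: "C 10 p [d, e, t, z, y, u] (t * n + n)"
    by (rule cycle_Inc[where r = 5 and p' = 11]) (use * assms Suc in \<open>auto simp: cycle_prog_def\<close>)
  have "C 9 p [d, e, Suc t, z, y, u] (t * n + n)"
    by (rule cycle_Dec[where r = 2 and p' = 10 and q = 24])
      (use * assms Suc in \<open>auto simp: cycle_prog_def\<close>)
  then show ?case by (simp add: add.commute)
qed

text \<open>
  Every $z' \le z$ is reached at address 8 along exactly one path, so that the numbers of accepting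
  paths add up by Pascal's rule.
\<close>

lemma cycle_lower:
  assumes "p \<le> length x"
    and "\<And>z' y'. z' + y' = z + y \<Longrightarrow> C 8 p [d, e, t, z', y', 0] ((z' + n choose n) * R)"
  shows "z + y < 2 ^ L \<Longrightarrow> C 5 p [d, e, t, z, y, 0] ((z + Suc n choose Suc n) * R)"
  using assms(2)
proof (induction z arbitrary: y)
  case 0
  have *: "C 6 p [d, e, t, 0, y, 0] 0"
    by (rule cycle_Dec_zero[where r = 3 and p' = 7 and q = 24])
      (use assms(1) cycle_reject in \<open>auto simp: cycle_prog_def\<close>)
  have **: "C 8 p [d, e, t, 0, y, 0] R"
    using 0(2)[of 0 y] by simp
  have "C 5 p [d, e, t, 0, y, 0] (0 + R)"
    by (rule cycle_Choose[OF * **]) (use assms(1) in \<open>auto simp: cycle_prog_def\<close>)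
  then show ?case by simp
next
  case (Suc z)
  have *: "C 5 p [d, e, t, z, Suc y, 0] ((z + Suc n choose Suc n) * R)"
    using Suc.prems by (intro Suc.IH) auto
  have *: "C 7 p [d, e, t, z, y, 0] ((z + Suc n choose Suc n) * R)"
    by (rule cycle_Inc[where r = 4 and p' = 5])
      (use * assms(1) Suc.prems in \<open>auto simp: cycle_prog_def\<close>)
  have *: "C 6 p [d, e, t, Suc z, y, 0] ((z + Suc n choose Suc n) * R)"
    by (rule cycle_Dec[where r = 3 and p' = 7 and q = 24])
      (use * assms(1) in \<open>auto simp: cycle_prog_def\<close>)
  have "C 5 p [d, e, t, Suc z, y, 0]
      ((z + Suc n choose Suc n) * R + (Suc z + n choose n) * R)"
    by (rule cycle_Choose[OF * Suc.prems(2)])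
      (use assms(1) in \<open>auto simp: cycle_prog_def\<close>)
  then show ?case by (simp add: algebra_simps)
qed

text \<open>
  A letter 1 when $d + 1$ rounds of its loop are left, including the current one: $z$ is lowered in all of these rounds,
  which raises the binomial coefficient from \<open>n\<close> to \<open>n + Suc d\<close>. A factor is
  contributed by the first \<open>d\<close> rounds only, since the last one is the one in which \<open>t\<close>
  becomes a multiple of the cycle length.
\<close>

lemma cycle_part:
  assumes "p \<le> length x"
  shows "Suc (d + e) < 2 ^ L \<Longrightarrow> z + y + t + Suc d < 2 ^ L \<Longrightarrow>
    (\<And>z' y'. z' + y' = z + y \<Longrightarrow>
      C 1 p [Suc (d + e), 0, t + Suc d, z', y', 0] ((z' + n choose n) * R)) \<Longrightarrow>
    C 3 p [d, e, t, z, y, 0] ((z + (n + Suc d) choose (n + Suc d)) * (pochhammer (Suc t) d * R))"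
proof (induction d arbitrary: e t z y)
  case 0
  have exit: "C 8 p [0, Suc e, Suc t, z', y', 0] ((z' + n choose n) * R)"
    if "z' + y' = z + y" for z' y'
  proof -
    have *: "C 16 p [0, Suc e, Suc t, z', y', 0] ((z' + n choose n) * R)"
      by (rule cycle_move[where r = 1 and r' = 0 and pc' = 17 and q = 1])
        (use assms 0 that in \<open>auto simp: cycle_prog_def\<close>)
    show ?thesis
      by (rule cycle_Dec_zero[where r = 0 and p' = 9 and q = 16])
        (use * assms in \<open>auto simp: cycle_prog_def\<close>)
  qed
  have *: "C 5 p [0, Suc e, Suc t, z, y, 0] ((z + Suc n choose Suc n) * R)"
    by (rule cycle_lower[OF assms exit]) (use 0 in auto)
  have *: "C 4 p [0, Suc e, t, z, y, 0] ((z + Suc n choose Suc n) * R)"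
    by (rule cycle_Inc[where r = 2 and p' = 5]) (use * assms 0 in \<open>auto simp: cycle_prog_def\<close>)
  have "C 3 p [0, e, t, z, y, 0] ((z + Suc n choose Suc n) * R)"
    by (rule cycle_Inc[where r = 1 and p' = 4]) (use * assms 0 in \<open>auto simp: cycle_prog_def\<close>)
  then show ?case by simp
next
  case (Suc d)
  let ?n = "n + Suc d" and ?R = "Suc t * (pochhammer (Suc (Suc t)) d * R)"
  have exit: "C 8 p [Suc d, Suc e, Suc t, z', y', 0] ((z' + ?n choose ?n) * ?R)"
    if "z' + y' = z + y" for z' y'
  proof -
    have *: "C 3 p [d, Suc e, Suc t, z', y', 0]
        ((z' + ?n choose ?n) * (pochhammer (Suc (Suc t)) d * R))"
      using Suc.prems that by (intro Suc.IH) auto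
    have "C 9 p [d, Suc e, Suc t, z', y', 0]
        (Suc t * ((z' + ?n choose ?n) * (pochhammer (Suc (Suc t)) d * R)))"
      by (rule cycle_multiply) (use * assms Suc.prems(2) that in auto)
    then have *: "C 9 p [d, Suc e, Suc t, z', y', 0] ((z' + ?n choose ?n) * ?R)"
      by (subst mult.left_commute)
    show ?thesis
      by (rule cycle_Dec[where r = 0 and p' = 9 and q = 16])
        (use * assms in \<open>auto simp: cycle_prog_def\<close>)
  qed
  have *: "C 5 p [Suc d, Suc e, Suc t, z, y, 0] ((z + Suc ?n choose Suc ?n) * ?R)"
    by (rule cycle_lower[OF assms exit]) (use Suc.prems in auto)
  have *: "C 4 p [Suc d, Suc e, t, z, y, 0] ((z + Suc ?n choose Suc ?n) * ?R)"
    by (rule cycle_Inc[where r = 2 and p' = 5]) (use * assms Suc in \<open>auto simp: cycle_prog_def\<close>)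
  have "C 3 p [Suc d, e, t, z, y, 0] ((z + Suc ?n choose Suc ?n) * ?R)"
    by (rule cycle_Inc[where r = 1 and p' = 4]) (use * assms Suc in \<open>auto simp: cycle_prog_def\<close>)
  moreover have "?R = pochhammer (Suc t) (Suc d) * R"
    by (simp add: pochhammer_rec algebra_simps)
  ultimately show ?case by simp
qed

text \<open>
  The letters 1 up to the end of a block. The following computation may depend on $z$ and $y$ only
  through their sum.
\<close>

lemma cycle_block:
  "i > 0 \<Longrightarrow> i < 2 ^ L \<Longrightarrow> z + y + t + i * m < 2 ^ L \<Longrightarrow>
    drop p x = replicate m True @ xs \<Longrightarrow>
    (\<And>z' y'. z' + y' = z + y \<Longrightarrow> C 1 (p + m) [i, 0, t + i * m, z', y', 0] R) \<Longrightarrow>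
    C 1 p [i, 0, t, z, y, 0]
      ((z + i * m choose (i * m)) * ((\<Prod>j<m. pochhammer (Suc (t + i * j)) (i - 1)) * R))"
proof (induction m arbitrary: p t z y)
  case 0
  then show ?case by simp
next
  case (Suc m)
  obtain d where i: "i = Suc d" using Suc.prems(1) by (cases i) auto
  let ?Q = "\<Prod>j<m. pochhammer (Suc (t + i + i * j)) d"
  have x: "drop p x = True # replicate m True @ xs"
    using Suc.prems by simp
  then have dp: "drop (Suc p) x = replicate m True @ xs"
    by (simp add: drop_Suc flip: tl_drop)
  have p: "Suc p \<le> length x"
    using x by (metis Suc_leI drop_all linorder_not_le list.distinct(1))
  have rest: "C 1 (Suc p) [Suc (d + 0), 0, t + Suc d, z', y', 0]
      ((z' + i * m choose (i * m)) * (?Q * R))"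
    if "z' + y' = z + y" for z' y'
    using Suc.IH[of z' y' "t + i" "Suc p"] Suc.prems that dp by (simp add: i algebra_simps)
  have *: "C 3 (Suc p) [d, 0, t, z, y, 0]
      ((z + (i * m + Suc d) choose (i * m + Suc d)) * (pochhammer (Suc t) d * (?Q * R)))"
    by (rule cycle_part[OF p _ _ rest]) (use Suc.prems in \<open>auto simp: i\<close>)
  have *: "C 2 (Suc p) [i, 0, t, z, y, 0]
      ((z + (i * m + Suc d) choose (i * m + Suc d)) * (pochhammer (Suc t) d * (?Q * R)))"
    by (rule cycle_Dec[where r = 0 and p' = 3 and q = 24])
      (use * p in \<open>auto simp: cycle_prog_def i\<close>)
  have "C 1 p [i, 0, t, z, y, 0]
      ((z + (i * m + Suc d) choose (i * m + Suc d)) * (pochhammer (Suc t) d * (?Q * R)))"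
    by (rule from_counts_Read[where q = 2 and q' = 18 and e = 23 and b = True, OF _ _ _ _ x])
      (use * in \<open>auto simp: cycle_prog_def\<close>)
  moreover have "i * m + Suc d = i * Suc m" by (simp add: i)
  moreover have "pochhammer (Suc t) d * ?Q = (\<Prod>j<Suc m. pochhammer (Suc (t + i * j)) (i - 1))"
    by (subst prod.lessThan_Suc_shift) (simp add: i algebra_simps)
  ultimately show ?case by (metis mult.assoc)
qed

text \<open>
  The numbers up to $(d + 1) m$ that are not multiples of $d + 1$ come in \<open>m\<close> runs of \<open>d\<close>
  consecutive numbers; the multiples contribute $(d + 1)^m m!$.
\<close>

lemma block_product:
  "(\<Prod>j<m. pochhammer (Suc (Suc d * j)) d) * (Suc d ^ m * fact m) = (fact (Suc d * m) :: nat)"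
proof (induction m)
  case (Suc m)
  have "(fact (Suc d * Suc m) :: nat) = fact (Suc d * m) * pochhammer (Suc (Suc d * m)) (Suc d)"
    using pochhammer_product'[of "1::nat" "Suc d * m" "Suc d"]
    by (simp add: pochhammer_fact algebra_simps)
  also have "pochhammer (Suc (Suc d * m)) (Suc d) = 
      pochhammer (Suc (Suc d * m)) d * (Suc d * Suc m)"
    by (simp add: pochhammer_Suc algebra_simps)
  finally show ?case
    unfolding Suc.IH[symmetric] by (simp add: algebra_simps)
qed simp

lemma block_factor:
  assumes "i > 0"
  shows "(S + i * m choose (i * m)) * (\<Prod>j<m. pochhammer (Suc (i * j)) (i - 1)) *
    (fact S * (i ^ m * fact m)) = fact (S + i * m)"
proof -
  obtain d where i: "i = Suc d" using assms by (cases i) auto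
  have "(S + i * m choose (i * m)) * (\<Prod>j<m. pochhammer (Suc (i * j)) (i - 1)) *
      (fact S * (i ^ m * fact m)) =
    ((\<Prod>j<m. pochhammer (Suc (Suc d * j)) d) * (Suc d ^ m * fact m)) * fact S *
      (S + i * m choose (i * m))"
    unfolding i diff_Suc_1 by (simp only: mult_ac)
  also have "\<dots> = fact (i * m) * fact (S + i * m - i * m) * (S + i * m choose (i * m))"
    unfolding block_product i by simp
  also have "\<dots> = fact (S + i * m)"
    by (rule binomial_fact_lemma) simp
  finally show ?thesis .
qed

text \<open>
  The rest of the input from the beginning of the block for cycles of length \<open>i\<close>, when the
  earlier blocks have total size \<open>S\<close>. The number of accepting paths is described by its product
  with the denominator, so that the quotient need not be proved to be exact on the way.
\<close>

lemma cycle_blocks: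
  "ms \<noteq> [] \<Longrightarrow> i > 0 \<Longrightarrow> i + length ms \<le> 2 ^ L \<Longrightarrow>
    S + (\<Sum>j<length ms. (i + j) * ms ! j) < 2 ^ L \<Longrightarrow> drop p x = encode ms \<Longrightarrow>
    p \<le> length x \<Longrightarrow>
    \<exists>c. C 1 p [i, 0, 0, S, 0, 0] c \<and>
      c * (fact S * (\<Prod>j<length ms. (i + j) ^ (ms ! j) * fact (ms ! j))) =
      fact (S + (\<Sum>j<length ms. (i + j) * ms ! j))"
proof (induction ms arbitrary: i S p rule: encode.induct)
  case 1
  then show ?case by simp
next
  case (2 m)
  let ?B = "(S + i * m choose (i * m)) * (\<Prod>j<m. pochhammer (Suc (i * j)) (i - 1))"
  have "length (drop p x) = m" using 2 by simp
  with 2(6) have p: "p + m = length x" by simp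
  have *: "C 23 (p + m) [i, 0, t, z, y, 0] 1" for t z y
    using from_counts_Stop[of cycle_prog 23 True "[i, 0, t, z, y, 0]" 6 x L "p + m"]
    by (simp add: cycle_prog_def)
  have exit: "C 1 (p + m) [i, 0, t, z, y, 0] 1" for t z y
    by (rule from_counts_Read_end[where q = 2 and q' = 18 and e = 23])
      (use * in \<open>auto simp: cycle_prog_def p\<close>)
  have "C 1 p [i, 0, 0, S, 0, 0] ((S + i * m choose (i * m)) *
      ((\<Prod>j<m. pochhammer (Suc (0 + i * j)) (i - 1)) * 1))"
    by (rule cycle_block[where xs = "[]", OF _ _ _ _ exit]) (use 2 in auto)
  moreover have "?B * (fact S * (i ^ m * fact m)) = fact (S + i * m)"
    using 2(2) by (rule block_factor)
  ultimately show ?case by (intro exI[of _ ?B]) simp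
next
  case (3 m m' ms)
  let ?B = "(S + i * m choose (i * m)) * (\<Prod>j<m. pochhammer (Suc (i * j)) (i - 1))"
  let ?S = "\<Sum>j<length (m' # ms). (Suc i + j) * (m' # ms) ! j"
  let ?P = "\<Prod>j<length (m' # ms). (Suc i + j) ^ ((m' # ms) ! j) * fact ((m' # ms) ! j)"
  have S: "(\<Sum>j<length (m # m' # ms). (i + j) * (m # m' # ms) ! j) = i * m + ?S"
    by (subst length_Cons, subst sum.lessThan_Suc_shift) simp
  have P: "(\<Prod>j<length (m # m' # ms). (i + j) ^ ((m # m' # ms) ! j) * fact ((m # m' # ms) ! j)) =
      i ^ m * fact m * ?P"
    by (subst length_Cons, subst prod.lessThan_Suc_shift) simp
  have dp: "drop (p + m) x = False # encode (m' # ms)"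
    using "3.prems"(5) by (simp add: add.commute flip: drop_drop)
  then have p: "p + m < length x"
    by (metis drop_all linorder_not_le list.distinct(1))
  have dp': "drop (Suc (p + m)) x = encode (m' # ms)"
    using dp by (simp add: drop_Suc flip: tl_drop)
  have "\<exists>c. C 1 (Suc (p + m)) [Suc i, 0, 0, S + i * m, 0, 0] c \<and>
      c * (fact (S + i * m) * ?P) = fact (S + i * m + ?S)"
    by (rule "3.IH") (use "3.prems" S p dp' in auto)
  then obtain c where c: "C 1 (Suc (p + m)) [Suc i, 0, 0, S + i * m, 0, 0] c"
      "c * (fact (S + i * m) * ?P) = fact (S + i * m + ?S)"
    by blast
  have bound: "S + i * m < 2 ^ L" using "3.prems"(4) S by simp
  have exit: "C 1 (p + m) [i, 0, i * m, z, y, 0] c" if zy: "z + y = S" for z y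
  proof -
    have *: "C 22 (Suc (p + m)) [i, 0, 0, S + i * m, 0, 0] c"
      by (rule cycle_Inc[where r = 0 and p' = 1])
        (use "3.prems" p c(1) in \<open>auto simp: cycle_prog_def\<close>)
    have *: "C 20 (Suc (p + m)) [i, 0, i * m, S, 0, 0] c"
      by (rule cycle_move[where r = 2 and r' = 3 and pc' = 21 and q = 22])
        (use * p bound in \<open>auto simp: cycle_prog_def add.commute\<close>)
    have *: "C 18 (Suc (p + m)) [i, 0, i * m, z, y, 0] c"
      by (rule cycle_move[where r = 4 and r' = 3 and pc' = 19 and q = 20])
        (use * p bound zy in \<open>auto simp: cycle_prog_def add.commute\<close>)
    show ?thesis
      by (rule from_counts_Read[where q = 2 and q' = 18 and e = 23, OF _ _ _ _ dp])
        (use * in \<open>auto simp: cycle_prog_def\<close>)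
  qed
  have "C 1 p [i, 0, 0, S, 0, 0] ((S + i * m choose (i * m)) *
      ((\<Prod>j<m. pochhammer (Suc (0 + i * j)) (i - 1)) * c))"
    by (rule cycle_block[where xs = "False # encode (m' # ms)"]) (use "3.prems" bound exit in auto)
  then have "C 1 p [i, 0, 0, S, 0, 0] (?B * c)"
    by (simp add: mult.assoc)
  moreover have "?B * c * (fact S * (i ^ m * fact m * ?P)) = fact (S + (i * m + ?S))"
  proof -
    have "?B * c * (fact S * (i ^ m * fact m * ?P)) =
        c * (?B * (fact S * (i ^ m * fact m)) * ?P)"
      by (simp only: mult_ac)
    also have "\<dots> = c * (fact (S + i * m) * ?P)"
      unfolding block_factor[OF "3.prems"(2)] ..
    finally show ?thesis
      using c(2) by (simp only: add.assoc)
  qed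
  ultimately show ?case unfolding S P by blast
qed

lemma counts_cycle_prog:
  assumes "x = encode ms" "ms \<noteq> []" "part_size ms < 2 ^ L" "Suc (length ms) \<le> 2 ^ L"
  shows "counts (counter_ntm 6 cycle_prog) x (L + 2) (init_config (counter_ntm 6 cycle_prog))
    (cycle_type_count x)"
proof -
  have "\<exists>c. C 1 0 [1, 0, 0, 0, 0, 0] c \<and>
      c * (fact 0 * (\<Prod>j<length ms. (1 + j) ^ (ms ! j) * fact (ms ! j))) =
      fact (0 + (\<Sum>j<length ms. (1 + j) * ms ! j))"
    using assms by (intro cycle_blocks) (auto simp: part_size_def)
  then obtain c where c: "C 1 0 [1, 0, 0, 0, 0, 0] c" "c * zee ms = fact (part_size ms)"
    by (auto simp: zee_def part_size_def)
  have "zee ms > 0"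
    by (auto simp: zee_def intro!: prod_pos)
  then have "c = cycle_type_count x"
    unfolding assms(1) cycle_type_count_encode c(2)[symmetric] by simp
  moreover have "(1::nat) < 2 ^ L"
    using assms(2,4) by (cases ms) auto
  with c(1) have "C 22 0 [0, 0, 0, 0, 0, 0] c"
    by (intro cycle_Inc[where r = 0 and p' = 1 and pc = 22]) (simp_all add: cycle_prog_def)
  then have "C 22 0 (replicate 6 0) c"
    by (simp add: numeral_eq_Suc)
  ultimately show ?thesis
    by (intro counts_init) (auto simp: cycle_prog_def)
qed

end

section \<open>Logarithmic space\<close>

lemma length_encode: "ms \<noteq> [] \<Longrightarrow> Suc (length (encode ms)) = sum_list ms + length ms"
  by (induction ms rule: encode.induct) auto

lemma part_size_le: "part_size ms \<le> length ms * sum_list ms"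
proof -
  have "part_size ms \<le> (\<Sum>i<length ms. length ms * ms ! i)"
    unfolding part_size_def by (intro sum_mono mult_right_mono) auto
  also have "\<dots> = length ms * sum_list ms"
    by (simp add: sum_list_sum_nth atLeast0LessThan sum_distrib_left)
  finally show ?thesis .
qed

text \<open>A number of digits that suffices for all counters on inputs of length \<open>n\<close>.\<close>

definition width :: "nat \<Rightarrow> nat" where
  "width n = 2 * nat \<lceil>log 2 (real (n + 2))\<rceil>"

lemma square_le_power_width: "(n + 2)\<^sup>2 \<le> 2 ^ width n"
proof -
  have "real (n + 2) = 2 powr (log 2 (real (n + 2)))"
    by simp
  also have "\<dots> \<le> 2 powr real (nat \<lceil>log 2 (real (n + 2))\<rceil>)"
    by (intro powr_mono real_nat_ceiling_ge) auto
  also have "\<dots> = real (2 ^ nat \<lceil>log 2 (real (n + 2))\<rceil>)"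
    by (subst powr_realpow) simp_all
  finally have "n + 2 \<le> 2 ^ nat \<lceil>log 2 (real (n + 2))\<rceil>"
    by (simp only: of_nat_le_iff)
  then have "(n + 2)\<^sup>2 \<le> (2 ^ nat \<lceil>log 2 (real (n + 2))\<rceil>)\<^sup>2"
    by (rule power_mono) simp
  then show ?thesis
    by (simp add: width_def mult.commute flip: power_mult)
qed

lemma width_bigo: "(\<lambda>n. real (width n + 2)) \<in> O(\<lambda>n. ln (real n))"
proof -
  have "(\<lambda>n. real (width n + 2)) \<in> O(\<lambda>n. 2 * log 2 (real (n + 2)) + 4)"
  proof (rule bigoI[of _ 1], intro always_eventually allI)
    fix n
    have "log 2 (real (n + 2)) \<ge> 0" by simp
    then have "real (width n) \<le> 2 * (log 2 (real (n + 2)) + 1)"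
      unfolding width_def by simp linarith
    then show "norm (real (width n + 2)) \<le> 1 * norm (2 * log 2 (real (n + 2)) + 4)"
      by simp
  qed
  also have "(\<lambda>n. 2 * log 2 (real (n + 2)) + 4) \<in> O(\<lambda>n. ln (real n))"
    by real_asymp
  finally show ?thesis .
qed

theorem theorem3p23:
  shows "cycle_type_count \<in> SharpL"
proof -
  let ?M = "counter_ntm 6 cycle_prog"
  have wf: "wf_ntm ?M" by (rule wf_counter_ntm)
  have counts: "counts ?M x (width (length x) + 2) (init_config ?M) (cycle_type_count x)" for x
  proof -
    obtain ms where ms: "x = encode ms" "ms \<noteq> []"
    proof -
      obtain ms where "x = encode ms" using encode_surj by blast
      \<comment> \<open>The empty list has the same code as the list of a single multiplicity 0.\<close>
      then show ?thesis using that[of ms] that[of "[0]"] by (cases "ms = []") auto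
    qed
    have len: "sum_list ms \<le> Suc (length x)" "length ms \<le> Suc (length x)"
      using length_encode[OF ms(2)] ms(1) by auto
    have "part_size ms \<le> Suc (length x) * Suc (length x)"
      using part_size_le[of ms] mult_mono[OF len(2,1)] by simp
    also have "\<dots> < (length x + 2)\<^sup>2"
      by (simp add: power2_eq_square)
    also note square_le_power_width
    finally have "part_size ms < 2 ^ width (length x)" .
    moreover have "Suc (length ms) \<le> (length x + 2)\<^sup>2"
      using len(2) by (simp add: power2_eq_square)
    with square_le_power_width[of "length x"] have "Suc (length ms) \<le> 2 ^ width (length x)"
      by linarith
    ultimately show ?thesis
      using ms by (intro counts_cycle_prog)
  qed
  have "halts_on_all_paths ?M x" for x
    using counts_no_infinite_run[OF counts] by (simp add: halts_on_all_paths_def)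
  moreover have "work_space_le ?M x (width (length x) + 2)" for x
    using counts_space[OF counts] by (auto simp: work_space_le_def)
  moreover have "cycle_type_count x = card (accepting_paths ?M x)" for x
    using counts_card[OF _ counts] wf by (simp add: wf_ntm_def accepting_paths_def)
  ultimately show ?thesis
    unfolding SharpL_def using wf width_bigo
    by (intro CollectI exI[of _ ?M] exI[of _ "\<lambda>n. width n + 2"]) simp
qed

end
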